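(* Let $X$ be a locale whose frame is given by a $\mathbf{DCPO}$-type presentation $\mathcal{O}X = \langle G \text{ dist. lattice} \mid R\rangle_{\mathbf{Frm}}$, and let $q\colon X \twoheadrightarrow Y$ be a triquotient with triquotiency assignment $q_\#\colon\mathcal{O}X\to\mathcal{O}Y$. Then $$\mathcal{O}Y \cong \langle \boxtimes g,\ g \in G \mid R,\ \boxtimes 1 = 1,\ \boxtimes 0 = 0,\ \boxtimes s \wedge \boxtimes t = \boxtimes(s \wedge q^*q_\#(t)),\ \boxtimes s \vee \boxtimes t = \boxtimes(s \vee q^*q_\#(t)),\ s,t \in G\rangle_{\mathbf{Frm}},$$ where the generators $\boxtimes g$ are indexed by the underlying set of $G$; for a specified representation $q^*q_\#(t) = \bigvee^{\uparrow}_{\beta} t_\beta$ in $\mathcal{O}X$ as a directed join of generators from $G$, $\boxtimes(s\wedge q^*q_\#(t))$ is interpreted as $\bigvee^{\uparrow}_{\beta} \boxtimes(s \wedge t_\beta)$ and $\boxtimes(s\vee q^*q_\#(t))$ as $\bigvee^{\uparrow}_{\beta} \boxtimes(s \vee t_\beta)$ (with $s\wedge t_\beta$ and $s\vee t_\beta$ computed in $G$); and each relation of $R$ is read with every generator $g$ replaced by $\boxtimes g$.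
   Context: For a locale $X$, $\mathcal{O}X$ denotes its frame; a locale map $f\colon X\to Y$ corresponds to a frame homomorphism $f^*\colon\mathcal{O}Y\to\mathcal{O}X$. A locale map $q\colon X\to Y$ is a triquotient (surjection) if there is a Scott-continuous (directed-join-preserving) map $q_\#\colon\mathcal{O}X\to\mathcal{O}Y$, called a triquotiency assignment, with $q_\#(a\wedge q^*(b)) = q_\#(a)\wedge b$ and $q_\#(a\vee q^*(b)) = q_\#(a)\vee b$ for all $a\in\mathcal{O}X$, $b\in\mathcal{O}Y$; then automatically $q_\# q^* = \mathrm{id}$. $\bigvee^{\uparrow}$ denotes a join of a directed family. $\langle G\mid R\rangle_{\mathbf{Frm}}$ denotes the frame presented by generators $G$ and relations $R$ (formal equalities and inequalities between elements of the free frame on $G$); "$G$ dist. lattice" means the free frame on the bounded distributive lattice $G$ is used (equivalently, relations are added forcing finite meets and joins, including $1$ and $0$, to agree with those in $G$). A presentation $\langle G \text{ dist. lattice}\mid R\rangle_{\mathbf{Frm}}$, $G$ a bounded distributive lattice, is $\mathbf{DCPO}$-type if every relation in $R$ has the form $\bigvee^{\uparrow} A \le \bigvee^{\uparrow} B$ with $A,B\subseteq G$ directed, and whenever this is in $R$, so are $\bigvee^{\uparrow}_{a\in A}(a\wedge c) \le \bigvee^{\uparrow}_{b\in B}(b\wedge c)$ and $\bigvee^{\uparrow}_{a\in A}(a\vee c) \le \bigvee^{\uparrow}_{b\in B}(b\vee c)$ for each $c\in G$. *)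

theory Defs
  imports Main "HOL-Library.FSet"
begin

section \<open>Frames, frame homomorphisms, triquotiency assignments\<close>

class frame = complete_lattice +
  assumes inf_Sup_distrib: "inf a (Sup B) = (SUP b\<in>B. inf a b)"

definition frame_hom :: "('a::frame \<Rightarrow> 'b::frame) \<Rightarrow> bool" where
  "frame_hom h \<longleftrightarrow>
     h top = top \<and> (\<forall>a b. h (inf a b) = inf (h a) (h b)) \<and> (\<forall>A. h (Sup A) = Sup (h ` A))"

definition directed :: "'a::order set \<Rightarrow> bool" where
  "directed D \<longleftrightarrow> D \<noteq> {} \<and> (\<forall>x\<in>D. \<forall>y\<in>D. \<exists>z\<in>D. x \<le> z \<and> y \<le> z)"

definition scott_continuous :: "('a::complete_lattice \<Rightarrow> 'b::complete_lattice) \<Rightarrow> bool" where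
  "scott_continuous f \<longleftrightarrow> (\<forall>D. directed D \<longrightarrow> f (Sup D) = Sup (f ` D))"

text \<open>A locale map \<open>q : X \<rightarrow> Y\<close> is given by its frame homomorphism \<open>qs : OY \<rightarrow> OX\<close>;
  \<open>qt : OX \<rightarrow> OY\<close> is the triquotiency assignment.\<close>

definition triquotiency_assignment :: "('y::frame \<Rightarrow> 'x::frame) \<Rightarrow> ('x \<Rightarrow> 'y) \<Rightarrow> bool" where
  "triquotiency_assignment qs qt \<longleftrightarrow>
     scott_continuous qt \<and>
     (\<forall>a b. qt (inf a (qs b)) = inf (qt a) b) \<and>
     (\<forall>a b. qt (sup a (qs b)) = sup (qt a) b)"

section \<open>The free frame on a set of generators\<close>

text \<open>The free meet-semilattice with top on a set consists of its finite subsets ordered by reverse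
  inclusion (\<open>F\<close> stands for the meet of its members), and the free frame on the set is the frame of
  down-sets of that semilattice, i.e. of inclusion-upward closed families of finite subsets.\<close>

typedef 'g free_frame = "{U :: 'g fset set. \<forall>F\<in>U. \<forall>F'. F |\<subseteq>| F' \<longrightarrow> F' \<in> U}"
  morphisms rep_ff abs_ff
  by (rule exI[of _ UNIV]) simp

lemma rep_ff_up: "F \<in> rep_ff U \<Longrightarrow> F |\<subseteq>| F' \<Longrightarrow> F' \<in> rep_ff U"
  using rep_ff[of U] by blast

instantiation free_frame :: (type) frame
begin

definition "less_eq_free_frame U V \<longleftrightarrow> rep_ff U \<subseteq> rep_ff V"
definition "less_free_frame U V \<longleftrightarrow> rep_ff U \<subset> rep_ff V"
definition "inf_free_frame U V = abs_ff (rep_ff U \<inter> rep_ff V)"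
definition "sup_free_frame U V = abs_ff (rep_ff U \<union> rep_ff V)"
definition "Inf_free_frame \<U> = abs_ff (\<Inter>U\<in>\<U>. rep_ff U)"
definition "Sup_free_frame \<U> = abs_ff (\<Union>U\<in>\<U>. rep_ff U)"
definition "top_free_frame = abs_ff UNIV"
definition "bot_free_frame = abs_ff {}"

lemma rep_ff_ops:
  "rep_ff (inf U V) = rep_ff U \<inter> rep_ff V"
  "rep_ff (sup U V) = rep_ff U \<union> rep_ff V"
  "rep_ff (Inf \<U>) = (\<Inter>U\<in>\<U>. rep_ff U)"
  "rep_ff (Sup \<U>) = (\<Union>U\<in>\<U>. rep_ff U)"
  "rep_ff top = UNIV"
  "rep_ff bot = {}"
  unfolding inf_free_frame_def sup_free_frame_def Inf_free_frame_def Sup_free_frame_def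
    top_free_frame_def bot_free_frame_def
  by (subst abs_ff_inverse; auto intro: rep_ff_up)+

instance
  by intro_classes
    (auto simp: less_eq_free_frame_def less_free_frame_def rep_ff_ops rep_ff_inject[symmetric])

end

definition gen :: "'g \<Rightarrow> 'g free_frame" where
  "gen g = abs_ff {F. g |\<in>| F}"

lemma rep_ff_gen: "rep_ff (gen g) = {F. g |\<in>| F}"
  unfolding gen_def by (subst abs_ff_inverse) auto

section \<open>Frame presentations\<close>

datatype 'a frame_relation = Eq 'a 'a | Le 'a 'a

definition frame_congruence :: "('a::frame \<times> 'a) set \<Rightarrow> bool" where
  "frame_congruence \<theta> \<longleftrightarrow>
     equiv UNIV \<theta> \<and>
     (\<forall>(a, b)\<in>\<theta>. \<forall>(c, d)\<in>\<theta>. (inf a c, inf b d) \<in> \<theta>) \<and>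
     (\<forall>S\<subseteq>\<theta>. (Sup (fst ` S), Sup (snd ` S)) \<in> \<theta>)"

fun holds_modulo :: "('a::frame \<times> 'a) set \<Rightarrow> 'a frame_relation \<Rightarrow> bool" where
  "holds_modulo \<theta> (Eq u v) \<longleftrightarrow> (u, v) \<in> \<theta>"
| "holds_modulo \<theta> (Le u v) \<longleftrightarrow> (inf u v, u) \<in> \<theta>"

definition generated_congruence ::
    "'g free_frame frame_relation set \<Rightarrow> ('g free_frame \<times> 'g free_frame) set" where
  "generated_congruence Rel =
     \<Inter>{\<theta>. frame_congruence \<theta> \<and> (\<forall>r\<in>Rel. holds_modulo \<theta> r)}"

definition presented_class ::
    "'g free_frame frame_relation set \<Rightarrow> 'g free_frame \<Rightarrow> 'g free_frame set" where
  "presented_class Rel u = generated_congruence Rel `` {u}"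

text \<open>The underlying set of the frame presented by \<open>Rel\<close>; its frame operations are those induced
  from the free frame.\<close>

definition presented_frame :: "'g free_frame frame_relation set \<Rightarrow> 'g free_frame set set" where
  "presented_frame Rel = UNIV // generated_congruence Rel"

text \<open>Frame isomorphisms out of a presented frame. As the operations on the quotient are computed
  on representatives, a map out of it is a homomorphism iff its composite with the quotient map is.\<close>

definition presentation_iso ::
    "'g free_frame frame_relation set \<Rightarrow> ('g free_frame set \<Rightarrow> 'x::frame) \<Rightarrow> bool" where
  "presentation_iso Rel \<phi> \<longleftrightarrow>
     bij_betw \<phi> (presented_frame Rel) UNIV \<and> frame_hom (\<lambda>u. \<phi> (presented_class Rel u))"

section \<open>Presentations over a distributive lattice\<close>

text \<open>The relations implicit in the qualifier ``dist. lattice''.\<close>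

definition lattice_relations ::
    "'g::{distrib_lattice, bounded_lattice} free_frame frame_relation set" where
  "lattice_relations =
     {Eq (gen top) top, Eq (gen bot) bot}
     \<union> {Eq (gen (inf a b)) (inf (gen a) (gen b)) | a b. True}
     \<union> {Eq (gen (sup a b)) (sup (gen a) (gen b)) | a b. True}"

text \<open>A pair \<open>(A, B)\<close> of sets of generators encodes the formal relation \<open>\<Squnion>A \<le> \<Squnion>B\<close>.\<close>

definition join_relations :: "('g set \<times> 'g set) set \<Rightarrow> 'g free_frame frame_relation set" where
  "join_relations R = {Le (SUP a\<in>A. gen a) (SUP b\<in>B. gen b) | A B. (A, B) \<in> R}"

definition dcpo_type :: "('g::{distrib_lattice, bounded_lattice} set \<times> 'g set) set \<Rightarrow> bool" where
  "dcpo_type R \<longleftrightarrow>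
     (\<forall>(A, B)\<in>R. directed A \<and> directed B \<and>
        (\<forall>c. ((\<lambda>a. inf a c) ` A, (\<lambda>b. inf b c) ` B) \<in> R \<and>
             ((\<lambda>a. sup a c) ` A, (\<lambda>b. sup b c) ` B) \<in> R))"

text \<open>Here \<open>gen g\<close> plays the role of \<open>\<box>g\<close>, and \<open>T t\<close> is the set of generators \<open>t\<^sub>\<beta>\<close> in the specified
  representation of \<open>q\<^sup>* (q\<^sub># t)\<close>. The lattice relations of \<open>G\<close> are deliberately not imposed.\<close>

definition box_relations ::
    "('g::{distrib_lattice, bounded_lattice} \<Rightarrow> 'g set) \<Rightarrow> 'g free_frame frame_relation set" where
  "box_relations T =
     {Eq (gen top) top, Eq (gen bot) bot}
     \<union> {Eq (inf (gen s) (gen t)) (SUP u\<in>T t. gen (inf s u)) | s t. True}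
     \<union> {Eq (sup (gen s) (gen t)) (SUP u\<in>T t. gen (sup s u)) | s t. True}"

section \<open>Universal properties\<close>

definition extend :: "('g \<Rightarrow> 'z::frame) \<Rightarrow> 'g free_frame \<Rightarrow> 'z" where
  "extend f U = (SUP F\<in>rep_ff U. INF g\<in>fset F. f g)"

lemma Sup_inf_distrib: "inf (Sup B) a = (SUP b\<in>B. inf b (a::'a::frame))"
  by (simp add: inf_commute[of _ a] inf_Sup_distrib)

lemma extend_gen: "extend f (gen g) = f g"
  unfolding extend_def rep_ff_gen
  by (rule antisym, rule SUP_least, auto intro: INF_lower SUP_upper2[of "{|g|}"])

lemma frame_hom_extend: "frame_hom (extend f)"
proof -
  have "extend f top = top"
    unfolding extend_def rep_ff_ops by (rule top_le, rule SUP_upper2[of "{||}"]) auto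
  moreover have "extend f (inf U V) = inf (extend f U) (extend f V)" for U V
  proof (rule antisym)
    show "extend f (inf U V) \<le> inf (extend f U) (extend f V)"
      unfolding extend_def rep_ff_ops by (intro le_infI SUP_subset_mono) auto
    have "inf (INF g\<in>fset F. f g) (INF g\<in>fset F'. f g) \<le> extend f (inf U V)"
      if "F \<in> rep_ff U" "F' \<in> rep_ff V" for F F'
    proof -
      have "F |\<union>| F' \<in> rep_ff (inf U V)"
        using that by (auto simp: rep_ff_ops intro: rep_ff_up)
      then show ?thesis
        unfolding extend_def by (rule SUP_upper2) (simp add: INF_union)
    qed
    then show "inf (extend f U) (extend f V) \<le> extend f (inf U V)"
      unfolding extend_def[of f U] extend_def[of f V]
      by (simp add: Sup_inf_distrib inf_Sup_distrib image_image SUP_le_iff)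
  qed
  moreover have "extend f (Sup \<U>) = Sup (extend f ` \<U>)" for \<U>
    unfolding extend_def rep_ff_ops by (simp add: SUP_UNION)
  ultimately show ?thesis
    by (auto simp: frame_hom_def)
qed

lemma frame_hom_fInf:
  assumes "frame_hom h"
  shows "h (INF g\<in>fset F. f g) = (INF g\<in>fset F. h (f g))"
  using assms by (induction F) (auto simp: frame_hom_def)

lemma rep_ff_INF_gen: "rep_ff (INF g\<in>fset F. gen g) = {F'. F |\<subseteq>| F'}"
  by (auto simp: rep_ff_ops rep_ff_gen)

lemma free_frame_decomp: "U = (SUP F\<in>rep_ff U. INF g\<in>fset F. gen g)"
proof -
  have "rep_ff (SUP F\<in>rep_ff U. INF g\<in>fset F. gen g) = (\<Union>F\<in>rep_ff U. {F'. F |\<subseteq>| F'})"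
    by (simp only: rep_ff_ops(4) image_image rep_ff_INF_gen)
  also have "\<dots> = rep_ff U"
    using rep_ff_up[of _ U] by blast
  finally show ?thesis
    by (simp add: rep_ff_inject)
qed

lemma extend_unique:
  assumes "frame_hom h" and "\<And>g. h (gen g) = f g"
  shows "h = extend f"
proof
  fix U
  have "h U = h (SUP F\<in>rep_ff U. INF g\<in>fset F. gen g)"
    using free_frame_decomp[of U] by simp
  also have "\<dots> = (SUP F\<in>rep_ff U. h (INF g\<in>fset F. gen g))"
    using assms(1) by (simp add: frame_hom_def image_image)
  also have "\<dots> = extend f U"
    by (simp only: frame_hom_fInf[OF assms(1)] assms(2) extend_def)
  finally show "h U = extend f U" .
qed

lemma frame_congruence_Inter:
  assumes "\<And>\<theta>. \<theta> \<in> C \<Longrightarrow> frame_congruence \<theta>"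
  shows "frame_congruence (\<Inter>C)"
proof -
  have equiv: "refl \<theta>" "sym \<theta>" "trans \<theta>" if "\<theta> \<in> C" for \<theta>
    using assms[OF that] by (auto simp: frame_congruence_def equiv_def)
  have "equiv UNIV (\<Inter>C)"
  proof (rule equivI)
    show "\<Inter>C \<subseteq> UNIV \<times> UNIV" by simp
    show "refl (\<Inter>C)"
      using equiv(1) by (auto simp: refl_on_def)
    show "sym (\<Inter>C)"
      by (rule symI) (meson equiv(2) symD InterD InterI)
    show "trans (\<Inter>C)"
      by (rule transI) (meson equiv(3) transD InterD InterI)
  qed
  moreover have "(inf a c, inf b d) \<in> \<Inter>C" if "(a, b) \<in> \<Inter>C" "(c, d) \<in> \<Inter>C" for a b c d
  proof
    fix \<theta> assume "\<theta> \<in> C"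
    then show "(inf a c, inf b d) \<in> \<theta>"
      using that assms[of \<theta>] unfolding frame_congruence_def by blast
  qed
  moreover have "(Sup (fst ` S), Sup (snd ` S)) \<in> \<Inter>C" if "S \<subseteq> \<Inter>C" for S
  proof
    fix \<theta> assume "\<theta> \<in> C"
    moreover from this that have "S \<subseteq> \<theta>" by blast
    ultimately show "(Sup (fst ` S), Sup (snd ` S)) \<in> \<theta>"
      using assms[of \<theta>] unfolding frame_congruence_def by blast
  qed
  ultimately show ?thesis
    unfolding frame_congruence_def by blast
qed

lemma frame_congruence_generated: "frame_congruence (generated_congruence Rel)"
  unfolding generated_congruence_def by (rule frame_congruence_Inter) simp

lemma generated_holds: "r \<in> Rel \<Longrightarrow> holds_modulo (generated_congruence Rel) r"
  by (cases r) (auto simp: generated_congruence_def)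

lemma frame_congruence_kernel:
  assumes "frame_hom h"
  shows "frame_congruence {(u, v). h u = h v}"
proof -
  have "h (Sup (fst ` S)) = h (Sup (snd ` S))" if "S \<subseteq> {(u, v). h u = h v}" for S
  proof -
    have "(\<lambda>p. h (fst p)) ` S = (\<lambda>p. h (snd p)) ` S"
      using that by (intro image_cong) auto
    then show ?thesis
      using assms by (simp add: frame_hom_def image_image)
  qed
  moreover have "equiv UNIV {(u, v). h u = h v}"
    by (rule equivI) (auto intro!: refl_onI symI transI)
  moreover have "h (inf a c) = inf (h a) (h c)" for a c
    using assms by (simp add: frame_hom_def)
  ultimately show ?thesis
    unfolding frame_congruence_def by auto
qed

lemma generated_congruence_least:
  assumes "frame_hom h"
    and "\<And>u v. Eq u v \<in> Rel \<Longrightarrow> h u = h v"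
    and "\<And>u v. Le u v \<in> Rel \<Longrightarrow> h u \<le> h v"
    and "(u, v) \<in> generated_congruence Rel"
  shows "h u = h v"
proof -
  have "holds_modulo {(u, v). h u = h v} r" if "r \<in> Rel" for r
    using that assms(1-3) by (cases r) (auto simp: frame_hom_def inf_absorb1)
  then show ?thesis
    using assms(4) frame_congruence_kernel[OF assms(1)] by (auto simp: generated_congruence_def)
qed

end

theory Submission
  imports Defs
begin

text \<open>
  The map \<open>\<box>g \<mapsto> q\<^sub># g\<close> respects the relations because \<open>q\<^sub>#\<close> is Scott continuous, and it is onto because
  \<open>G\<close> generates \<open>OX\<close> under directed joins. For injectivity, \<open>DCPO\<close>-stability of \<open>R\<close> implies that,
  for \<open>V \<subseteq> G\<close> directed in \<open>OX\<close>, the inequality \<open>g \<le> \<Squnion>V\<close> holds in \<open>OX\<close> iff \<open>g\<close> is reached from \<open>V\<close> by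
  passing to smaller elements and applying relations of \<open>R\<close>, without forming finite joins. Applied to
  the representation of \<open>q\<^sup>*q\<^sub># t\<close> this gives \<open>\<box>g \<le> \<box>t\<close> whenever \<open>g \<le> q\<^sup>*q\<^sub># t\<close>, although monotonicity of
  \<open>\<box>\<close> is not among the relations. Hence every \<open>u\<close> in the presented frame is the join of those \<open>\<box>g\<close> for
  which \<open>g \<le> q\<^sup>*y\<close>, where \<open>y\<close> is the image of \<open>u\<close> in \<open>OY\<close>.
\<close>

section \<open>Frame homomorphisms and congruences\<close>

lemma frame_hom_sup: "frame_hom h \<Longrightarrow> h (sup a b) = sup (h a) (h b)"
  unfolding frame_hom_def by (metis Sup_insert Sup_empty sup_bot_right image_insert image_empty)

lemma frame_hom_bot: "frame_hom h \<Longrightarrow> h bot = bot"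
  unfolding frame_hom_def by (metis Sup_empty image_empty)

lemma frame_hom_SUP: "frame_hom h \<Longrightarrow> h (SUP a\<in>A. f a) = (SUP a\<in>A. h (f a))"
  by (simp add: frame_hom_def image_image)

lemma frame_hom_mono: "frame_hom h \<Longrightarrow> a \<le> b \<Longrightarrow> h a \<le> h b"
  unfolding frame_hom_def by (metis inf.absorb_iff2 inf.commute)

lemma directed_image_nonempty: "directed (f ` D) \<Longrightarrow> D \<noteq> {}"
  by (simp add: directed_def)

lemma directed_imageD:
  "directed (f ` D) \<Longrightarrow> x \<in> D \<Longrightarrow> y \<in> D \<Longrightarrow> \<exists>z\<in>D. f x \<le> f z \<and> f y \<le> f z"
  by (simp add: directed_def)

text \<open>Trades a bijection on congruence classes for a surjective homomorphism on the free frame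
  whose kernel is the generated congruence; presentations are handled in this form
  throughout.\<close>

lemma presentation_isoD:
  assumes "presentation_iso Rel \<phi>"
  shows "frame_hom (\<lambda>u. \<phi> (presented_class Rel u))"
    and "surj (\<lambda>u. \<phi> (presented_class Rel u))"
    and "\<phi> (presented_class Rel u) = \<phi> (presented_class Rel v) \<longleftrightarrow> (u, v) \<in> generated_congruence Rel"
proof -
  have eq: "equiv UNIV (generated_congruence Rel)"
    using frame_congruence_generated[of Rel] by (simp add: frame_congruence_def)
  have bij: "bij_betw \<phi> (presented_frame Rel) UNIV"
    using assms by (simp add: presentation_iso_def)
  show "frame_hom (\<lambda>u. \<phi> (presented_class Rel u))"
    using assms by (simp add: presentation_iso_def)
  have range: "range (presented_class Rel) = presented_frame Rel"
    by (auto simp: presented_class_def presented_frame_def quotient_def)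
  then show "surj (\<lambda>u. \<phi> (presented_class Rel u))"
    using bij by (metis bij_betw_imp_surj_on image_image)
  have "\<phi> (presented_class Rel u) = \<phi> (presented_class Rel v)
      \<longleftrightarrow> presented_class Rel u = presented_class Rel v"
    using bij range by (intro inj_on_eq_iff[of \<phi> "presented_frame Rel"]) (auto simp: bij_betw_def)
  then show "\<phi> (presented_class Rel u) = \<phi> (presented_class Rel v)
      \<longleftrightarrow> (u, v) \<in> generated_congruence Rel"
    using eq_equiv_class_iff[OF eq] by (simp add: presented_class_def)
qed

lemma presentation_isoI:
  fixes h :: "'g free_frame \<Rightarrow> 'a::frame"
  assumes hom: "frame_hom h" and surj: "surj h"
    and ker: "\<And>u v. h u = h v \<longleftrightarrow> (u, v) \<in> generated_congruence Rel"
  shows "\<exists>\<psi> :: 'g free_frame set \<Rightarrow> 'a. presentation_iso Rel \<psi>"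
proof -
  \<comment> \<open>The choice of representative is harmless: by \<open>ker\<close>,
    \<open>h\<close> is constant on each class.\<close>
  define \<psi> where "\<psi> C = h (SOME u. u \<in> C)" for C
  have \<psi>: "\<psi> (presented_class Rel u) = h u" for u
  proof -
    have "u \<in> presented_class Rel u"
      using ker[of u u] by (simp add: presented_class_def)
    then have "(SOME v. v \<in> presented_class Rel u) \<in> presented_class Rel u"
      by (rule someI)
    then show ?thesis
      using ker by (metis \<psi>_def presented_class_def Image_singleton_iff)
  qed
  have frame: "presented_frame Rel = range (presented_class Rel)"
    by (auto simp: presented_class_def presented_frame_def quotient_def)
  have cls: "presented_class Rel u = presented_class Rel v" if "h u = h v" for u v
    using that by (simp add: presented_class_def Image_singleton ker[symmetric])
  have "bij_betw \<psi> (presented_frame Rel) UNIV"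
    unfolding bij_betw_def frame
  proof
    show "inj_on \<psi> (range (presented_class Rel))"
      using cls by (intro inj_onI) (metis \<psi> imageE)
    show "\<psi> ` range (presented_class Rel) = UNIV"
      using surj by (simp only: image_image \<psi>)
  qed
  then have "presentation_iso Rel \<psi>"
    using hom by (simp add: presentation_iso_def \<psi>)
  then show ?thesis
    by blast
qed

section \<open>The order of the quotient frame, on representatives\<close>

definition le_mod :: "('a::frame \<times> 'a) set \<Rightarrow> 'a \<Rightarrow> 'a \<Rightarrow> bool" where
  "le_mod \<theta> u v \<longleftrightarrow> (inf u v, u) \<in> \<theta>"

context
  fixes \<theta> :: "('a::frame \<times> 'a) set"
  assumes cong: "frame_congruence \<theta>"
begin

lemma cong_refl: "(u, u) \<in> \<theta>"
  and cong_sym: "(u, v) \<in> \<theta> \<Longrightarrow> (v, u) \<in> \<theta>"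
  and cong_trans: "(u, v) \<in> \<theta> \<Longrightarrow> (v, w) \<in> \<theta> \<Longrightarrow> (u, w) \<in> \<theta>"
  and cong_inf: "(a, b) \<in> \<theta> \<Longrightarrow> (c, d) \<in> \<theta> \<Longrightarrow> (inf a c, inf b d) \<in> \<theta>"
  using cong unfolding frame_congruence_def equiv_def
  by (blast dest: refl_onD symD transD)+

lemma cong_SUP:
  assumes "\<And>a. a \<in> A \<Longrightarrow> (f a, g a) \<in> \<theta>"
  shows "(SUP a\<in>A. f a, SUP a\<in>A. g a) \<in> \<theta>"
proof -
  have "(\<lambda>a. (f a, g a)) ` A \<subseteq> \<theta>"
    using assms by auto
  then have "(Sup (fst ` (\<lambda>a. (f a, g a)) ` A), Sup (snd ` (\<lambda>a. (f a, g a)) ` A)) \<in> \<theta>"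
    using cong unfolding frame_congruence_def by blast
  then show ?thesis
    by (simp add: image_image)
qed

lemma le_mod_le: "u \<le> v \<Longrightarrow> le_mod \<theta> u v"
  by (simp add: le_mod_def inf_absorb1 cong_refl)

lemma le_mod_cong: "(u, v) \<in> \<theta> \<Longrightarrow> le_mod \<theta> u v"
  unfolding le_mod_def using cong_inf[OF cong_refl[of u], of u v] by (metis cong_sym inf_idem)

lemma le_mod_trans:
  assumes "le_mod \<theta> u v" "le_mod \<theta> v w"
  shows "le_mod \<theta> u w"
proof -
  have "(inf (inf u v) w, inf u w) \<in> \<theta>"
    using assms(1) by (simp add: le_mod_def cong_inf cong_refl)
  moreover have "(inf u (inf v w), inf u v) \<in> \<theta>"
    using assms(2) by (simp add: le_mod_def cong_inf cong_refl)
  ultimately show ?thesis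
    using assms(1) unfolding le_mod_def by (metis cong_sym cong_trans inf_assoc)
qed

lemma le_mod_antisym: "le_mod \<theta> u v \<Longrightarrow> le_mod \<theta> v u \<Longrightarrow> (u, v) \<in> \<theta>"
  unfolding le_mod_def by (metis cong_sym cong_trans inf_commute)

lemma le_mod_SUP_least:
  assumes "\<And>a. a \<in> A \<Longrightarrow> le_mod \<theta> (f a) v"
  shows "le_mod \<theta> (SUP a\<in>A. f a) v"
  using cong_SUP[of A "\<lambda>a. inf (f a) v" f] assms
  by (simp add: le_mod_def Sup_inf_distrib image_image)

lemma le_mod_sup_least:
  assumes "le_mod \<theta> a v" "le_mod \<theta> b v"
  shows "le_mod \<theta> (sup a b) v"
  using le_mod_SUP_least[of "{a, b}" "\<lambda>x. x" v] assms by auto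

end

lemma generated_le_mod: "Le u v \<in> Rel \<Longrightarrow> le_mod (generated_congruence Rel) u v"
  using generated_holds[of "Le u v" Rel] by (simp add: le_mod_def)

lemma generated_cong: "Eq u v \<in> Rel \<Longrightarrow> (u, v) \<in> generated_congruence Rel"
  using generated_holds[of "Eq u v" Rel] by simp

section \<open>Covers generated by a \<open>DCPO\<close>-type presentation\<close>

text \<open>Closure under finite joins is deliberately absent: \<open>gen\<close> does not preserve
  them modulo the box relations, so only these three rules can be transported there.\<close>

inductive_set cover :: "('g::order set \<times> 'g set) set \<Rightarrow> 'g set \<Rightarrow> 'g set"
  for R :: "('g set \<times> 'g set) set" and V :: "'g set" where
  base: "v \<in> V \<Longrightarrow> v \<in> cover R V"
| lower: "w \<in> cover R V \<Longrightarrow> w' \<le> w \<Longrightarrow> w' \<in> cover R V"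
| relation: "(A, B) \<in> R \<Longrightarrow> (\<And>b. b \<in> B \<Longrightarrow> b \<in> cover R V) \<Longrightarrow> a \<in> A \<Longrightarrow> a \<in> cover R V"

lemma cover_least:
  assumes "V \<subseteq> I" "\<And>w w'. w \<in> I \<Longrightarrow> w' \<le> w \<Longrightarrow> w' \<in> I"
    and "\<And>A B. (A, B) \<in> R \<Longrightarrow> B \<subseteq> I \<Longrightarrow> A \<subseteq> I"
  shows "cover R V \<subseteq> I"
proof
  fix x assume "x \<in> cover R V"
  then show "x \<in> I"
    by induction (use assms in blast)+
qed

lemma cover_mono: "V \<subseteq> W \<Longrightarrow> cover R V \<subseteq> cover R W"
  by (rule cover_least) (auto intro: cover.intros)

section \<open>Ideals closed under the relations\<close>

definition relation_ideal :: "('g::bounded_lattice set \<times> 'g set) set \<Rightarrow> 'g set \<Rightarrow> bool" where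
  "relation_ideal R I \<longleftrightarrow> bot \<in> I \<and> (\<forall>w\<in>I. \<forall>w'\<le>w. w' \<in> I) \<and> (\<forall>x\<in>I. \<forall>y\<in>I. sup x y \<in> I) \<and>
     (\<forall>(A, B)\<in>R. B \<subseteq> I \<longrightarrow> A \<subseteq> I)"

lemma relation_idealD: "relation_ideal R I \<Longrightarrow> (A, B) \<in> R \<Longrightarrow> B \<subseteq> I \<Longrightarrow> A \<subseteq> I"
  unfolding relation_ideal_def by blast

context
  fixes R :: "('g::{distrib_lattice, bounded_lattice} set \<times> 'g set) set"
  assumes R: "dcpo_type R"
begin

lemma dcpo_type_inf: "(A, B) \<in> R \<Longrightarrow> ((\<lambda>a. inf a c) ` A, (\<lambda>b. inf b c) ` B) \<in> R"
  and dcpo_type_sup: "(A, B) \<in> R \<Longrightarrow> ((\<lambda>a. sup a c) ` A, (\<lambda>b. sup b c) ` B) \<in> R"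
  and dcpo_type_directed: "(A, B) \<in> R \<Longrightarrow> directed A" "(A, B) \<in> R \<Longrightarrow> directed B"
  using R unfolding dcpo_type_def by blast+

text \<open>Induction on the derivation of \<open>y\<close>: joining every step with
  \<open>x\<close> gives a derivation again, because \<open>R\<close> is stable under joins with a
  fixed element.\<close>

lemma sup_in_cover:
  assumes "\<And>v. v \<in> V \<Longrightarrow> sup v x \<in> cover R V" "y \<in> cover R V"
  shows "sup y x \<in> cover R V"
  using assms(2)
proof induction
  case (base v)
  then show ?case
    by (rule assms(1))
next
  case (lower w w')
  then show ?case
    by (meson cover.lower sup_mono order_refl)
next
  case (relation A B a)
  show ?case
    by (rule cover.relation[OF dcpo_type_sup[OF relation(1), of x]]) (use relation in auto)
qed

text \<open>Closure under joins spreads from \<open>V\<close> to the whole cover by two uses of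
  \<open>sup_in_cover\<close>: first one argument runs through the cover while the other stays in
  \<open>V\<close>, then the other is freed too.\<close>

lemma relation_ideal_cover:
  assumes "V \<noteq> {}" "\<And>v v'. v \<in> V \<Longrightarrow> v' \<in> V \<Longrightarrow> sup v v' \<in> cover R V"
  shows "relation_ideal R (cover R V)"
proof -
  have *: "sup v y \<in> cover R V" if "v \<in> V" "y \<in> cover R V" for v y
    using sup_in_cover[of V v y] assms(2) that by (simp add: sup_commute)
  have "sup x y \<in> cover R V" if "x \<in> cover R V" "y \<in> cover R V" for x y
    by (rule sup_in_cover[OF *]) (use that in auto)
  moreover have "bot \<in> cover R V"
    using assms(1) by (metis bot_least cover.base cover.lower ex_in_conv)
  ultimately show ?thesis
    by (auto simp: relation_ideal_def intro: cover.lower cover.relation)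
qed

text \<open>This set is the Heyting implication from the ideal generated by \<open>C\<close> to
  \<open>I\<close>. Stability of \<open>R\<close> under meets gives closure under the relations,
  distributivity gives closure under joins.\<close>

lemma relation_ideal_residual:
  assumes "relation_ideal R I"
  shows "relation_ideal R {x. \<forall>c\<in>C. inf x c \<in> I}"
proof -
  have "inf a c \<in> I" if AB: "(A, B) \<in> R" and B: "\<forall>b\<in>B. inf b c \<in> I" and "a \<in> A" for A B a c
  proof -
    have "(\<lambda>b. inf b c) ` B \<subseteq> I"
      using B by auto
    then have "(\<lambda>a. inf a c) ` A \<subseteq> I"
      by (rule relation_idealD[OF assms dcpo_type_inf[OF AB]])
    then show ?thesis
      using \<open>a \<in> A\<close> by blast
  qed
  moreover have "inf w' c \<in> I" if "inf w c \<in> I" "w' \<le> w" for w w' c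
    using assms that unfolding relation_ideal_def by (meson inf_mono order_refl)
  moreover have "inf bot c \<in> I" for c
    using assms by (simp add: relation_ideal_def)
  moreover have "inf (sup x y) c \<in> I" if "inf x c \<in> I" "inf y c \<in> I" for x y c
    using assms that by (simp add: relation_ideal_def inf_sup_distrib2)
  ultimately show ?thesis
    unfolding relation_ideal_def by blast
qed

end

section \<open>Bounding elements of the free frame by relation ideals\<close>

definition fmeet :: "'g::bounded_lattice fset \<Rightarrow> 'g" where
  "fmeet F = ffold inf top F"

interpretation fmeet: comp_fun_idem "inf :: 'g::bounded_lattice \<Rightarrow> _"
  by standard (auto simp: fun_eq_iff inf_left_commute)

lemma fmeet_empty: "fmeet {||} = top"
  by (simp add: fmeet_def)

lemma fmeet_insert: "fmeet (finsert x F) = inf x (fmeet F)"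
  by (simp add: fmeet_def fmeet.ffold_finsert_idem)

lemma fmeet_union: "fmeet (F |\<union>| F') = inf (fmeet F) (fmeet F')"
  by (induction F) (auto simp: fmeet_empty fmeet_insert inf_assoc)

lemma fmeet_lower: "g |\<in>| F \<Longrightarrow> fmeet F \<le> g"
  by (induction F) (auto simp: fmeet_insert intro: le_infI2)

text \<open>Reading \<open>U\<close> as the join of the finite meets \<open>fmeet F\<close>, this
  says that its value in the frame of relation ideals lies below \<open>I\<close>.\<close>

definition bounded_by :: "'g::bounded_lattice free_frame \<Rightarrow> 'g set \<Rightarrow> bool" where
  "bounded_by U I \<longleftrightarrow> (\<forall>F\<in>rep_ff U. fmeet F \<in> I)"

lemma bounded_by_Sup: "bounded_by (Sup \<U>) I \<longleftrightarrow> (\<forall>U\<in>\<U>. bounded_by U I)"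
  by (auto simp: bounded_by_def rep_ff_ops)

lemma bounded_by_sup: "bounded_by (sup U V) I \<longleftrightarrow> bounded_by U I \<and> bounded_by V I"
  by (auto simp: bounded_by_def rep_ff_ops)

text \<open>The adjunction between meet and implication. For \<open>F\<close> in \<open>U\<close>
  and \<open>F'\<close> in \<open>V\<close>, the union of \<open>F\<close> and \<open>F'\<close>
  lies in both families, and its meet is the meet of \<open>fmeet F\<close> and
  \<open>fmeet F'\<close>.\<close>

lemma bounded_by_inf: "bounded_by (inf U V) I \<longleftrightarrow> bounded_by U {x. \<forall>c\<in>fmeet ` rep_ff V. inf x c \<in> I}"
proof -
  have "fmeet F \<in> I" if "\<forall>F\<in>rep_ff U. \<forall>F'\<in>rep_ff V. inf (fmeet F) (fmeet F') \<in> I"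
    "F \<in> rep_ff U" "F \<in> rep_ff V" for F
    using that by (metis inf_idem)
  moreover have "inf (fmeet F) (fmeet F') \<in> I"
    if "\<forall>F\<in>rep_ff U \<inter> rep_ff V. fmeet F \<in> I" "F \<in> rep_ff U" "F' \<in> rep_ff V" for F F'
    using that rep_ff_up[of F U "F |\<union>| F'"] rep_ff_up[of F' V "F |\<union>| F'"]
    by (auto simp: fmeet_union[symmetric])
  ultimately show ?thesis
    by (auto simp: bounded_by_def rep_ff_ops)
qed

lemma bounded_by_gen:
  assumes "relation_ideal R I"
  shows "bounded_by (gen g) I \<longleftrightarrow> g \<in> I"
proof -
  have "fmeet {|g|} = g"
    by (simp add: fmeet_insert fmeet_empty)
  moreover have "fmeet F \<in> I" if "g \<in> I" "g |\<in>| F" for F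
    using assms that fmeet_lower unfolding relation_ideal_def by blast
  ultimately show ?thesis
    by (metis (no_types, lifting) bounded_by_def rep_ff_gen mem_Collect_eq finsertI1)
qed

lemma bounded_by_top:
  assumes "relation_ideal R I"
  shows "bounded_by top I \<longleftrightarrow> top \<in> I"
proof -
  have "fmeet F \<in> I" if "top \<in> I" for F
    using assms that unfolding relation_ideal_def by (meson top_greatest)
  then show ?thesis
    unfolding bounded_by_def rep_ff_ops by (auto simp: fmeet_empty dest: spec[of _ "{||}"])
qed

text \<open>\<open>OX\<close> is the frame of relation ideals; rather than constructing it as a type, we use the
  congruence on the free frame that it induces.\<close>

lemma bounded_by_congruent:
  assumes R: "dcpo_type R"
    and uv: "(u, v) \<in> generated_congruence (lattice_relations \<union> join_relations R)"
    and I: "relation_ideal R I"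
  shows "bounded_by u I \<longleftrightarrow> bounded_by v I"
proof -
  define \<theta> where "\<theta> = {(u, v). \<forall>I. relation_ideal R I \<longrightarrow> (bounded_by u I \<longleftrightarrow> bounded_by v I)}"
  have inf1: "(inf a c, inf b c) \<in> \<theta>" if "(a, b) \<in> \<theta>" for a b c
  proof -
    \<comment> \<open>A bound \<open>I\<close> on a meet with \<open>c\<close> is a bound by a
      residual of \<open>I\<close>, again a relation ideal, to which the hypothesis on
      \<open>a\<close> and \<open>b\<close> applies.\<close>
    have "bounded_by (inf a c) I \<longleftrightarrow> bounded_by (inf b c) I" if "relation_ideal R I" for I
      using \<open>(a, b) \<in> \<theta>\<close> relation_ideal_residual[OF R that, of "fmeet ` rep_ff c"]
      by (simp only: \<theta>_def bounded_by_inf mem_Collect_eq case_prod_conv)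
    then show ?thesis
      by (simp add: \<theta>_def)
  qed
  have trans: "trans \<theta>"
    by (rule transI) (auto simp: \<theta>_def)
  have "equiv UNIV \<theta>"
    using trans by (intro equivI) (auto simp: \<theta>_def intro!: refl_onI symI)
  moreover have "(inf a c, inf b d) \<in> \<theta>" if "(a, b) \<in> \<theta>" "(c, d) \<in> \<theta>" for a b c d
    using transD[OF trans inf1[OF that(1), of c] inf1[OF that(2), of b, unfolded inf_commute[of _ b]]] .
  moreover have "(Sup (fst ` S), Sup (snd ` S)) \<in> \<theta>" if "S \<subseteq> \<theta>" for S
    using that unfolding \<theta>_def by (fastforce simp: bounded_by_Sup)
  ultimately have "frame_congruence \<theta>"
    unfolding frame_congruence_def by blast
  moreover have "holds_modulo \<theta> r" if "r \<in> lattice_relations" for r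
  proof -
    have "bounded_by (gen (inf a b)) I \<longleftrightarrow> bounded_by (inf (gen a) (gen b)) I"
      if I: "relation_ideal R I" for a b I
    proof -
      have J: "relation_ideal R {x. inf x y \<in> I}" for y
        using relation_ideal_residual[OF R I, of "{y}"] by simp
      have "bounded_by (inf (gen a) (gen b)) I \<longleftrightarrow> (\<forall>c\<in>fmeet ` rep_ff (gen b). inf a c \<in> I)"
        unfolding bounded_by_inf
        by (subst bounded_by_gen[OF relation_ideal_residual[OF R I]]) simp
      also have "\<dots> \<longleftrightarrow> bounded_by (gen b) {x. inf x a \<in> I}"
        by (simp add: bounded_by_def inf_commute)
      also have "\<dots> \<longleftrightarrow> inf a b \<in> I"
        by (simp add: bounded_by_gen[OF J] inf_commute)
      finally show ?thesis
        using I by (simp add: bounded_by_gen)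
    qed
    moreover have "bounded_by (gen (sup a b)) I \<longleftrightarrow> bounded_by (sup (gen a) (gen b)) I"
      if I: "relation_ideal R I" for a b I
      using I unfolding bounded_by_gen[OF I] bounded_by_sup relation_ideal_def
      by (meson sup_ge1 sup_ge2)
    moreover have "bounded_by (gen top) I \<longleftrightarrow> bounded_by top I" if "relation_ideal R I" for I
      using that by (simp add: bounded_by_gen bounded_by_top)
    moreover have "bounded_by (gen bot) I \<longleftrightarrow> bounded_by bot I" if I: "relation_ideal R I" for I
      using I unfolding bounded_by_gen[OF I] by (simp add: bounded_by_def rep_ff_ops relation_ideal_def)
    ultimately show ?thesis
      using that by (auto simp: lattice_relations_def \<theta>_def)
  qed
  moreover have "holds_modulo \<theta> r" if "r \<in> join_relations R" for r
  proof -
    obtain A B where AB: "(A, B) \<in> R" and r: "r = Le (SUP a\<in>A. gen a) (SUP b\<in>B. gen b)"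
      using \<open>r \<in> join_relations R\<close> by (auto simp: join_relations_def)
    have "bounded_by (inf (SUP a\<in>A. gen a) (SUP b\<in>B. gen b)) I \<longleftrightarrow> bounded_by (SUP a\<in>A. gen a) I"
      if I: "relation_ideal R I" for I
    proof
      assume "bounded_by (SUP a\<in>A. gen a) I"
      then show "bounded_by (inf (SUP a\<in>A. gen a) (SUP b\<in>B. gen b)) I"
        unfolding bounded_by_def rep_ff_ops(1) by blast
    next
      assume "bounded_by (inf (SUP a\<in>A. gen a) (SUP b\<in>B. gen b)) I"
      then have ab: "inf b a \<in> I" if "a \<in> A" "b \<in> B" for a b
      proof -
        assume "bounded_by (inf (SUP a\<in>A. gen a) (SUP b\<in>B. gen b)) I"
        moreover have "{|a, b|} \<in> rep_ff (inf (SUP a\<in>A. gen a) (SUP b\<in>B. gen b))"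
          using that by (auto simp: rep_ff_ops rep_ff_gen)
        ultimately have "fmeet {|a, b|} \<in> I"
          unfolding bounded_by_def by blast
        then show ?thesis
          by (simp add: fmeet_insert fmeet_empty inf_commute)
      qed
      have "a \<in> I" if "a \<in> A" for a
      proof -
        \<comment> \<open>The relation met with \<open>a\<close> is again in \<open>R\<close>, and
          its left side contains \<open>inf a a\<close>; so knowing the meets \<open>inf b a\<close>
          is enough to get \<open>a\<close> itself.\<close>
        have "(\<lambda>b. inf b a) ` B \<subseteq> I"
          using ab that by blast
        then have "(\<lambda>x. inf x a) ` A \<subseteq> I"
          by (rule relation_idealD[OF I dcpo_type_inf[OF R AB]])
        then have "inf a a \<in> I"
          using that by blast
        then show ?thesis
          by simp
      qed
      then show "bounded_by (SUP a\<in>A. gen a) I"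
        by (simp add: bounded_by_Sup bounded_by_gen[OF I])
    qed
    then show ?thesis
      by (simp add: r \<theta>_def)
  qed
  ultimately have "generated_congruence (lattice_relations \<union> join_relations R) \<subseteq> \<theta>"
    unfolding generated_congruence_def by (intro Inter_lower) auto
  then have "(u, v) \<in> \<theta>"
    using uv ..
  then show ?thesis
    using I by (simp add: \<theta>_def)
qed

section \<open>Triquotients of a \<open>DCPO\<close>-type presentation\<close>

text \<open>\<open>k\<close> stands for the quotient map of the free frame followed by the
  isomorphism onto \<open>OX\<close>. The sets \<open>T t\<close> are directed only after applying
  \<eta>, not necessarily as subsets of the lattice.\<close>

locale presented_triquotient =
  fixes R :: "('g::{distrib_lattice, bounded_lattice} set \<times> 'g set) set"
    and k :: "'g free_frame \<Rightarrow> 'x::frame"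
    and \<eta> :: "'g \<Rightarrow> 'x"
    and qs :: "'y::frame \<Rightarrow> 'x"
    and qt :: "'x \<Rightarrow> 'y"
    and T :: "'g \<Rightarrow> 'g set"
  assumes R: "dcpo_type R"
    and k_hom: "frame_hom k"
    and k_surj: "surj k"
    and k_ker: "k u = k v \<longleftrightarrow> (u, v) \<in> generated_congruence (lattice_relations \<union> join_relations R)"
    and \<eta>: "\<eta> g = k (gen g)"
    and qs: "frame_hom qs"
    and qt: "triquotiency_assignment qs qt"
    and T_directed: "directed (\<eta> ` T t)"
    and T: "qs (qt (\<eta> t)) = (SUP u\<in>T t. \<eta> u)"
begin

abbreviation box_cong :: "('g free_frame \<times> 'g free_frame) set" where
  "box_cong \<equiv> generated_congruence (join_relations R \<union> box_relations T)"

abbreviation box_le :: "'g free_frame \<Rightarrow> 'g free_frame \<Rightarrow> bool" (infix "\<lesssim>" 50) where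
  "u \<lesssim> v \<equiv> le_mod box_cong u v"

section \<open>Generators in \<open>OX\<close> and their covers\<close>

lemma \<eta>_top: "\<eta> top = top" and \<eta>_bot: "\<eta> bot = bot"
  and \<eta>_inf: "\<eta> (inf a b) = inf (\<eta> a) (\<eta> b)"
  and \<eta>_sup: "\<eta> (sup a b) = sup (\<eta> a) (\<eta> b)"
proof -
  have *: "k u = k v" if "Eq u v \<in> lattice_relations" for u v
    using that by (simp add: k_ker generated_cong)
  show "\<eta> top = top"
    using *[of "gen top" top] k_hom by (simp add: \<eta> lattice_relations_def frame_hom_def)
  show "\<eta> bot = bot"
    using *[of "gen bot" bot] frame_hom_bot[OF k_hom] by (simp add: \<eta> lattice_relations_def)
  show "\<eta> (inf a b) = inf (\<eta> a) (\<eta> b)"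
    using *[of "gen (inf a b)" "inf (gen a) (gen b)"] k_hom
    by (auto simp: \<eta> lattice_relations_def frame_hom_def)
  show "\<eta> (sup a b) = sup (\<eta> a) (\<eta> b)"
    using *[of "gen (sup a b)" "sup (gen a) (gen b)"] frame_hom_sup[OF k_hom]
    by (auto simp: \<eta> lattice_relations_def)
qed

lemma \<eta>_mono: "a \<le> b \<Longrightarrow> \<eta> a \<le> \<eta> b"
  by (metis \<eta>_inf inf.absorb_iff2 inf.commute)

lemma \<eta>_relation:
  assumes "(A, B) \<in> R"
  shows "(SUP a\<in>A. \<eta> a) \<le> (SUP b\<in>B. \<eta> b)"
proof -
  let ?u = "SUP a\<in>A. gen a" and ?v = "SUP b\<in>B. gen b"
  have "Le ?u ?v \<in> lattice_relations \<union> join_relations R"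
    using assms by (auto simp: join_relations_def)
  then have "k (inf ?u ?v) = k ?u"
    using generated_le_mod[of ?u ?v] by (simp add: k_ker le_mod_def)
  then have "inf (k ?u) (k ?v) = k ?u"
    using k_hom by (simp add: frame_hom_def)
  then show ?thesis
    by (simp add: frame_hom_SUP[OF k_hom] \<eta> le_iff_inf)
qed

text \<open>The cover is a relation ideal bounding the join of \<open>V\<close>. Bounds by relation
  ideals respect equality in \<open>OX\<close>, so it bounds \<open>gen g\<close> as well.\<close>

lemma in_cover:
  assumes "V \<noteq> {}" "\<And>v v'. v \<in> V \<Longrightarrow> v' \<in> V \<Longrightarrow> sup v v' \<in> cover R V"
    and le: "\<eta> g \<le> (SUP v\<in>V. \<eta> v)"
  shows "g \<in> cover R V"
proof -
  let ?V = "SUP v\<in>V. gen v"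
  have I: "relation_ideal R (cover R V)"
    by (rule relation_ideal_cover[OF R]) (use assms in auto)
  have "k (inf (gen g) ?V) = k (gen g)"
    using le k_hom frame_hom_SUP[OF k_hom, of gen V] by (simp add: frame_hom_def \<eta> le_iff_inf)
  then have "bounded_by (gen g) (cover R V) \<longleftrightarrow> bounded_by (inf (gen g) ?V) (cover R V)"
    using bounded_by_congruent[OF R _ I] by (simp add: k_ker)
  moreover have "bounded_by ?V (cover R V)"
    by (simp add: bounded_by_Sup bounded_by_gen[OF I] cover.base)
  then have "bounded_by (inf (gen g) ?V) (cover R V)"
    unfolding bounded_by_def rep_ff_ops(1) by blast
  ultimately show ?thesis
    by (simp add: bounded_by_gen[OF I])
qed

lemma in_cover_directed:
  assumes "directed (\<eta> ` V)" "\<eta> g \<le> (SUP v\<in>V. \<eta> v)"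
  shows "g \<in> cover R V"
proof (rule in_cover[OF _ _ assms(2)])
  show "V \<noteq> {}"
    using assms(1) by (rule directed_image_nonempty)
  fix v v' assume "v \<in> V" "v' \<in> V"
  then obtain w where w: "w \<in> V" "\<eta> v \<le> \<eta> w" "\<eta> v' \<le> \<eta> w"
    using directed_imageD[OF assms(1)] by blast
  \<comment> \<open>In the lattice itself \<open>sup v v'\<close> may fail to be below
    \<open>w\<close>; the inequality in \<open>OX\<close> still makes it covered by
    \<open>{w}\<close>.\<close>
  then have "\<eta> (sup v v') \<le> (SUP v\<in>{w}. \<eta> v)"
    by (simp add: \<eta>_sup)
  then have "sup v v' \<in> cover R {w}"
    by (rule in_cover[rotated 2]) (simp_all add: cover.base)
  then show "sup v v' \<in> cover R V"
    by (rule subsetD[OF cover_mono, rotated]) (use w(1) in simp)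
qed

section \<open>Calculation modulo the box relations\<close>

lemma box_congruence: "frame_congruence box_cong"
  by (rule frame_congruence_generated)

lemmas box_refl = cong_refl[OF box_congruence]
  and box_sym = cong_sym[OF box_congruence]
  and box_trans = cong_trans[OF box_congruence]
  and box_le_le = le_mod_le[OF box_congruence]
  and box_le_cong = le_mod_cong[OF box_congruence]
  and box_le_trans[trans] = le_mod_trans[OF box_congruence]
  and box_le_antisym = le_mod_antisym[OF box_congruence]
  and box_le_SUP_least = le_mod_SUP_least[OF box_congruence]
  and box_le_sup_least = le_mod_sup_least[OF box_congruence]

lemma box_relation: "(A, B) \<in> R \<Longrightarrow> (SUP a\<in>A. gen a) \<lesssim> (SUP b\<in>B. gen b)"
  by (rule generated_le_mod) (auto simp: join_relations_def)

lemma box_top: "(gen top, top) \<in> box_cong"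
  and box_bot: "(gen bot, bot) \<in> box_cong"
  and box_inf: "(inf (gen s) (gen t), SUP u\<in>T t. gen (inf s u)) \<in> box_cong"
  and box_sup: "(sup (gen s) (gen t), SUP u\<in>T t. gen (sup s u)) \<in> box_cong"
  by (rule generated_cong; force simp: box_relations_def)+

text \<open>The meet relation at \<open>s = top\<close>, where \<open>gen top\<close> is congruent
  to \<open>top\<close>.\<close>

lemma box_SUP_T: "(gen t, SUP u\<in>T t. gen u) \<in> box_cong"
proof -
  have "(inf (gen top) (gen t), inf top (gen t)) \<in> box_cong"
    by (rule cong_inf[OF box_congruence box_top box_refl])
  then show ?thesis
    using box_inf[of top t] by (auto intro: box_trans box_sym)
qed

text \<open>The generators below \<open>u\<close> are closed under the relations of
  \<open>R\<close>, which are imposed on boxes too. That they form a lower set is a hypothesis,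
  since monotonicity of \<open>gen\<close> modulo the congruence is proved only afterwards.\<close>

lemma box_cover:
  assumes lower: "\<And>w w'. gen w \<lesssim> u \<Longrightarrow> w' \<le> w \<Longrightarrow> gen w' \<lesssim> u"
    and V: "\<And>v. v \<in> V \<Longrightarrow> gen v \<lesssim> u" and "g \<in> cover R V"
  shows "gen g \<lesssim> u"
proof -
  have "A \<subseteq> {w. gen w \<lesssim> u}" if "(A, B) \<in> R" "B \<subseteq> {w. gen w \<lesssim> u}" for A B
  proof
    fix a assume "a \<in> A"
    then have "gen a \<lesssim> (SUP a\<in>A. gen a)"
      by (intro box_le_le SUP_upper)
    also note box_relation[OF that(1)]
    also have "(SUP b\<in>B. gen b) \<lesssim> u"
      using that(2) by (intro box_le_SUP_least) auto
    finally show "a \<in> {w. gen w \<lesssim> u}" by simp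
  qed
  then have "cover R V \<subseteq> {w. gen w \<lesssim> u}"
    using lower V by (intro cover_least) auto
  then show ?thesis
    using assms(3) by auto
qed

text \<open>The hypothesis puts \<open>g\<close> in the cover of \<open>T t\<close>, so it suffices
  to find a set closed under the cover rules that contains \<open>T t\<close> and whose members
  \<open>w\<close> satisfy the claim.\<close>

lemma box_le_if_le_saturation:
  assumes "\<eta> g \<le> qs (qt (\<eta> t))"
  shows "gen g \<lesssim> gen t"
proof -
  text \<open>Quantifying over \<open>c\<close> makes this set a lower set before \<open>\<box>\<close> is known to be monotone.\<close>
  let ?I = "{w. \<forall>c. gen (inf c w) \<lesssim> gen t}"
  have "gen (inf c v) \<lesssim> gen t" if "v \<in> T t" for c v
  proof -
    have "gen (inf c v) \<lesssim> (SUP v\<in>T t. gen (inf c v))"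
      using that by (intro box_le_le SUP_upper)
    also have "\<dots> \<lesssim> inf (gen c) (gen t)"
      by (rule box_le_cong[OF box_sym[OF box_inf]])
    also have "\<dots> \<lesssim> gen t"
      by (rule box_le_le) simp
    finally show ?thesis .
  qed
  then have "T t \<subseteq> ?I" by blast
  moreover have "w' \<in> ?I" if "w \<in> ?I" "w' \<le> w" for w w'
  proof safe
    fix c
    \<comment> \<open>Membership of \<open>w\<close> is used at \<open>inf c w'\<close> in place of
      \<open>c\<close>.\<close>
    have "inf (inf c w') w = inf c w'"
      using that(2) by (metis inf.absorb1 inf_assoc)
    moreover have "gen (inf (inf c w') w) \<lesssim> gen t"
      using that(1) by blast
    ultimately show "gen (inf c w') \<lesssim> gen t"
      by simp
  qed
  \<comment> \<open>Here stability under meets is essential: the relation met with \<open>c\<close>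
    is itself imposed on boxes.\<close>
  moreover have "A \<subseteq> ?I" if AB: "(A, B) \<in> R" and B: "B \<subseteq> ?I" for A B
  proof safe
    fix a c assume "a \<in> A"
    then have "gen (inf c a) \<lesssim> (SUP x\<in>(\<lambda>a. inf a c) ` A. gen x)"
      by (intro box_le_le SUP_upper) (auto simp: inf_commute)
    also note box_relation[OF dcpo_type_inf[OF R AB]]
    also have "(SUP x\<in>(\<lambda>b. inf b c) ` B. gen x) \<lesssim> gen t"
      using B by (intro box_le_SUP_least) (auto simp: inf_commute)
    finally show "gen (inf c a) \<lesssim> gen t" .
  qed
  ultimately have "cover R (T t) \<subseteq> ?I"
    by (rule cover_least)
  moreover have "g \<in> cover R (T t)"
    using assms T_directed by (intro in_cover_directed) (simp_all add: T)
  ultimately have "gen (inf top g) \<lesssim> gen t"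
    by blast
  then show ?thesis by simp
qed

lemma T_le_saturation: "v \<in> T t \<Longrightarrow> \<eta> v \<le> qs (qt (\<eta> t))"
  by (simp add: T SUP_upper)

section \<open>Laws of the triquotiency assignment\<close>

lemma qt_Sup: "directed D \<Longrightarrow> qt (Sup D) = Sup (qt ` D)"
  and qt_inf: "qt (inf a (qs b)) = inf (qt a) b"
  and qt_sup: "qt (sup a (qs b)) = sup (qt a) b"
  using qt by (auto simp: triquotiency_assignment_def scott_continuous_def)

lemma qt_SUP: "directed (f ` D) \<Longrightarrow> qt (SUP d\<in>D. f d) = (SUP d\<in>D. qt (f d))"
  using qt_Sup[of "f ` D"] by (simp add: image_image)

lemma qs_top: "qs top = top"
  using qs by (simp add: frame_hom_def)

lemma qt_top: "qt top = top"
  using qt_sup[of bot top] by (simp add: qs_top)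

lemma qt_bot: "qt bot = bot"
  using qt_inf[of top bot] by (simp add: frame_hom_bot[OF qs])

lemma qt_qs: "qt (qs b) = b"
  using qt_inf[of top b] by (simp add: qt_top)

lemma qt_mono:
  assumes "a \<le> b"
  shows "qt a \<le> qt b"
proof -
  have "directed {a, b}"
    using assms by (auto simp: directed_def)
  from qt_Sup[OF this] assms show ?thesis
    by (simp add: sup_absorb2 le_iff_sup)
qed

lemma saturation_mono: "a \<le> b \<Longrightarrow> qs (qt a) \<le> qs (qt b)"
  by (intro frame_hom_mono[OF qs] qt_mono)

text \<open>\<open>box_le_if_le_saturation\<close> does not apply to \<open>s\<close> directly, as
  \<eta> \<open>s\<close> need not lie below \<open>qs (qt (\<eta> t))\<close>. It does apply to
  each member of \<open>T s\<close>, and these join to \<open>gen s\<close>.\<close>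

lemma box_mono:
  assumes "s \<le> t"
  shows "gen s \<lesssim> gen t"
proof -
  have "gen s \<lesssim> (SUP v\<in>T s. gen v)"
    by (rule box_le_cong[OF box_SUP_T])
  also have "\<dots> \<lesssim> gen t"
    using T_le_saturation saturation_mono[OF \<eta>_mono[OF assms]]
    by (intro box_le_SUP_least box_le_if_le_saturation) (meson order_trans)
  finally show ?thesis .
qed

lemma directed_image:
  assumes "directed D" "\<And>x y. x \<le> y \<Longrightarrow> f x \<le> f y"
  shows "directed (f ` D)"
proof -
  have "\<exists>z\<in>D. f x \<le> f z \<and> f y \<le> f z" if "x \<in> D" "y \<in> D" for x y
    using assms that unfolding directed_def by metis
  moreover have "D \<noteq> {}"
    using assms(1) by (simp add: directed_def)
  ultimately show ?thesis
    by (simp add: directed_def)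
qed

lemma directed_\<eta>_inf: "directed ((\<lambda>u. \<eta> (inf s u)) ` T t)"
  using directed_image[OF T_directed[of t], of "inf (\<eta> s)"]
  by (auto simp: image_image \<eta>_inf intro: le_infI2)

lemma directed_\<eta>_sup: "directed ((\<lambda>u. \<eta> (sup s u)) ` T t)"
  using directed_image[OF T_directed[of t], of "sup (\<eta> s)"]
  by (auto simp: image_image \<eta>_sup intro: le_supI2)

text \<open>The meet law of \<open>qt\<close> with second argument
  \<open>qs (qt (\<eta> t))\<close>, followed by Scott continuity along the directed
  representation.\<close>

lemma qt_\<eta>_inf: "inf (qt (\<eta> s)) (qt (\<eta> t)) = (SUP u\<in>T t. qt (\<eta> (inf s u)))"
proof -
  have "inf (qt (\<eta> s)) (qt (\<eta> t)) = qt (inf (\<eta> s) (SUP u\<in>T t. \<eta> u))"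
    by (simp add: qt_inf T[symmetric])
  also have "inf (\<eta> s) (SUP u\<in>T t. \<eta> u) = (SUP u\<in>T t. \<eta> (inf s u))"
    by (simp add: \<eta>_inf inf_Sup_distrib image_image)
  finally show ?thesis
    by (simp add: qt_SUP directed_\<eta>_inf)
qed

lemma qt_\<eta>_sup: "sup (qt (\<eta> s)) (qt (\<eta> t)) = (SUP u\<in>T t. qt (\<eta> (sup s u)))"
proof -
  \<comment> \<open>A binary join distributes only over nonempty joins.\<close>
  have "T t \<noteq> {}"
    by (rule directed_image_nonempty[OF T_directed])
  have "sup (qt (\<eta> s)) (qt (\<eta> t)) = qt (sup (\<eta> s) (SUP u\<in>T t. \<eta> u))"
    by (simp add: qt_sup T[symmetric])
  also have "sup (\<eta> s) (SUP u\<in>T t. \<eta> u) = (SUP u\<in>T t. \<eta> (sup s u))"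
    using \<open>T t \<noteq> {}\<close> by (simp add: \<eta>_sup SUP_sup_distrib[symmetric])
  finally show ?thesis
    by (simp add: qt_SUP directed_\<eta>_sup)
qed

section \<open>The comparison homomorphism and its kernel\<close>

definition box_map :: "'g free_frame \<Rightarrow> 'y" where
  "box_map = extend (\<lambda>g. qt (\<eta> g))"

lemma box_map_hom: "frame_hom box_map"
  by (simp add: box_map_def frame_hom_extend)

lemma box_map_gen: "box_map (gen g) = qt (\<eta> g)"
  by (simp add: box_map_def extend_gen)

lemma box_map_SUP_gen: "box_map (SUP a\<in>A. gen (f a)) = (SUP a\<in>A. qt (\<eta> (f a)))"
  by (simp add: frame_hom_SUP[OF box_map_hom] box_map_gen)

lemma directed_\<eta>: "directed A \<Longrightarrow> directed (\<eta> ` A)"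
  by (rule directed_image) (auto intro: \<eta>_mono)

lemma box_map_cong:
  assumes "(u, v) \<in> box_cong"
  shows "box_map u = box_map v"
proof (rule generated_congruence_least[OF box_map_hom _ _ assms])
  fix u v assume "Eq u v \<in> join_relations R \<union> box_relations T"
  then show "box_map u = box_map v"
    using box_map_hom qt_\<eta>_inf qt_\<eta>_sup frame_hom_sup[OF box_map_hom] frame_hom_bot[OF box_map_hom]
    by (auto simp: join_relations_def box_relations_def box_map_SUP_gen box_map_gen
        frame_hom_def \<eta>_top \<eta>_bot qt_top qt_bot)
next
  fix u v assume "Le u v \<in> join_relations R \<union> box_relations T"
  then obtain A B where AB: "(A, B) \<in> R" "u = (SUP a\<in>A. gen a)" "v = (SUP b\<in>B. gen b)"
    by (auto simp: join_relations_def box_relations_def)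
  \<comment> \<open>The sides are directed, so \<open>qt\<close> passes through both joins.\<close>
  show "box_map u \<le> box_map v"
    using qt_mono[OF \<eta>_relation[OF AB(1)]] dcpo_type_directed[OF R AB(1)]
    by (simp add: AB(2,3) box_map_SUP_gen qt_SUP directed_\<eta>)
qed

text \<open>Elements of the free frame are joins of finite meets of generators, and since \<eta>
  preserves finite meets, each such meet is the image of a single generator.\<close>

lemma \<eta>_generates: "(SUP g\<in>{g. \<eta> g \<le> x}. \<eta> g) = x"
proof (rule antisym)
  obtain U where x: "x = k U"
    using k_surj by (metis surjD)
  have "(INF g\<in>fset F. \<eta> g) = \<eta> (fmeet F)" for F
    by (induction F) (simp_all add: fmeet_empty fmeet_insert \<eta>_top \<eta>_inf)
  moreover have "k = extend \<eta>"
    by (rule extend_unique[OF k_hom]) (simp add: \<eta>)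
  ultimately have "x = (SUP F\<in>rep_ff U. \<eta> (fmeet F))"
    by (simp add: x extend_def)
  then show "x \<le> (SUP g\<in>{g. \<eta> g \<le> x}. \<eta> g)"
    by (metis (mono_tags, lifting) SUP_least SUP_upper mem_Collect_eq)
qed (auto intro: SUP_least)

definition box_section :: "'y \<Rightarrow> 'g free_frame" where
  "box_section y = (SUP g\<in>{g. \<eta> g \<le> qs y}. gen g)"

text \<open>The indexing set is an ideal, hence directed, so Scott continuity applies and
  \<open>qt_qs\<close> finishes.\<close>

lemma box_map_section: "box_map (box_section y) = y"
proof -
  have "directed (\<eta> ` {g. \<eta> g \<le> qs y})"
  proof (rule directed_\<eta>)
    have "\<eta> bot \<le> qs y"
      by (simp add: \<eta>_bot)
    moreover have "\<eta> (sup a b) \<le> qs y" if "\<eta> a \<le> qs y" "\<eta> b \<le> qs y" for a b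
      using that by (simp add: \<eta>_sup)
    ultimately show "directed {g. \<eta> g \<le> qs y}"
      unfolding directed_def by (metis (mono_tags) empty_iff mem_Collect_eq sup_ge1 sup_ge2)
  qed
  from qt_SUP[OF this] have "box_map (box_section y) = qt (SUP g\<in>{g. \<eta> g \<le> qs y}. \<eta> g)"
    by (simp add: box_section_def box_map_SUP_gen)
  then show ?thesis
    by (simp add: \<eta>_generates qt_qs)
qed

text \<open>Repeated use of the meet relation removes one meet at a time; the empty meet is
  represented by \<open>gen top\<close>.\<close>

lemma box_INF: "\<exists>S. (INF g\<in>fset F. gen g, SUP s\<in>S. gen s) \<in> box_cong"
proof (induction F)
  case empty
  show ?case
    using box_sym[OF box_top] by (intro exI[of _ "{top}"]) simp
next
  case (insert t F)
  then obtain S where S: "(INF g\<in>fset F. gen g, SUP s\<in>S. gen s) \<in> box_cong"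
    by blast
  have "(INF g\<in>fset (finsert t F). gen g, inf (gen t) (SUP s\<in>S. gen s)) \<in> box_cong"
    using cong_inf[OF box_congruence box_refl S] by simp
  also have "inf (gen t) (SUP s\<in>S. gen s) = (SUP s\<in>S. inf (gen t) (gen s))"
    by (simp add: inf_Sup_distrib image_image)
  finally have "(INF g\<in>fset (finsert t F). gen g, SUP s\<in>S. SUP u\<in>T s. gen (inf t u)) \<in> box_cong"
    by (rule box_trans) (intro cong_SUP[OF box_congruence] box_inf)
  also have "(SUP s\<in>S. SUP u\<in>T s. gen (inf t u)) = (SUP g\<in>(\<Union>s\<in>S. inf t ` T s). gen g)"
    by (simp add: SUP_UNION image_image)
  finally show ?case by blast
qed

lemma box_SUP: "\<exists>S. (u, SUP s\<in>S. gen s) \<in> box_cong"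
proof -
  obtain S where "\<And>F. (INF g\<in>fset F. gen g, SUP s\<in>S F. gen s) \<in> box_cong"
    using box_INF by metis
  then have "(SUP F\<in>rep_ff u. INF g\<in>fset F. gen g, SUP F\<in>rep_ff u. SUP s\<in>S F. gen s) \<in> box_cong"
    by (intro cong_SUP[OF box_congruence])
  also have "(SUP F\<in>rep_ff u. SUP s\<in>S F. gen s) = (SUP s\<in>(\<Union>F\<in>rep_ff u. S F). gen s)"
    by (simp add: SUP_UNION)
  finally show ?thesis
    using free_frame_decomp[of u] by auto
qed

text \<open>Writing \<open>u\<close> as a join of boxes shows that \<open>qs (box_map u)\<close>
  lies below the join of \<open>M\<close>. Any \<open>g\<close> below it is then covered by
  \<open>M\<close>, and \<open>box_cover\<close> turns this into an inequality below
  \<open>u\<close>.\<close>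

lemma box_section_le: "box_section (box_map u) \<lesssim> u"
proof -
  text \<open>\<open>{g. \<box>g \<le> u}\<close> need not be closed under joins because \<open>q\<^sup>*q\<^sub>#\<close> is not inflationary; \<open>M\<close> is,
    up to covers.\<close>
  define M where "M = {x. \<exists>g. gen g \<lesssim> u \<and> \<eta> x \<le> qs (qt (\<eta> g))}"
  have lower: "gen w' \<lesssim> u" if "gen w \<lesssim> u" "w' \<le> w" for w w'
    using box_le_trans[OF box_mono that(1)] that(2) .
  have M_u: "gen x \<lesssim> u" if "x \<in> M" for x
    using that box_le_if_le_saturation box_le_trans unfolding M_def by blast
  have "gen bot \<lesssim> bot" and "bot \<lesssim> u"
    using box_bot by (auto intro: box_le_cong box_le_le)
  then have "gen bot \<lesssim> u"
    by (rule box_le_trans)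
  moreover have "\<eta> bot \<le> z" for z
    by (simp add: \<eta>_bot)
  ultimately have "M \<noteq> {}"
    unfolding M_def by blast
  have M_sup: "sup x1 x2 \<in> cover R M" if x: "x1 \<in> M" "x2 \<in> M" for x1 x2
  proof -
    obtain g1 g2 where g: "gen g1 \<lesssim> u" "\<eta> x1 \<le> qs (qt (\<eta> g1))" "gen g2 \<lesssim> u" "\<eta> x2 \<le> qs (qt (\<eta> g2))"
      using x unfolding M_def by blast
    \<comment> \<open>The saturations \<open>p w\<close> have join
      \<open>sup (qs (qt (\<eta> g1))) (qs (qt (\<eta> g2)))\<close> by
      \<open>qt_\<eta>_sup\<close>, which is above \<eta> \<open>(sup x1 x2)\<close>. The generators
      below some \<open>p w\<close> form a directed set with at least that join, and the join
      relation for \<open>g1\<close> and \<open>g2\<close> places them in \<open>M\<close>.\<close>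
    define p where "p w = qs (qt (\<eta> (sup g1 w)))" for w
    define N where "N = {x. \<exists>w\<in>T g2. \<eta> x \<le> p w}"
    have "gen (sup g1 w) \<lesssim> u" if "w \<in> T g2" for w
    proof -
      have "gen (sup g1 w) \<lesssim> (SUP w\<in>T g2. gen (sup g1 w))"
        using that by (intro box_le_le SUP_upper)
      also have "\<dots> \<lesssim> sup (gen g1) (gen g2)"
        by (rule box_le_cong[OF box_sym[OF box_sup]])
      also have "\<dots> \<lesssim> u"
        using g by (intro box_le_sup_least)
      finally show ?thesis .
    qed
    then have "N \<subseteq> M"
      unfolding N_def M_def p_def by blast
    have p: "directed (p ` T g2)"
      unfolding p_def using directed_image[OF directed_\<eta>_sup[of g1 g2], of "\<lambda>x. qs (qt x)"]
      by (simp add: image_image saturation_mono)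
    have "directed N"
      unfolding directed_def
    proof (intro conjI ballI)
      show "N \<noteq> {}"
        using directed_image_nonempty[OF p] unfolding N_def
        by (auto intro!: exI[of _ bot] simp: \<eta>_bot)
      fix x y assume "x \<in> N" "y \<in> N"
      then obtain w w' where w: "w \<in> T g2" "\<eta> x \<le> p w" "w' \<in> T g2" "\<eta> y \<le> p w'"
        unfolding N_def by blast
      then obtain w'' where "w'' \<in> T g2" "p w \<le> p w''" "p w' \<le> p w''"
        using directed_imageD[OF p] by blast
      with w have "sup x y \<in> N"
        unfolding N_def by (auto simp: \<eta>_sup intro!: bexI[of _ w''])
      then show "\<exists>z\<in>N. x \<le> z \<and> y \<le> z"
        by (meson sup_ge1 sup_ge2)
    qed
    have "\<eta> (sup x1 x2) \<le> sup (qs (qt (\<eta> g1))) (qs (qt (\<eta> g2)))"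
      unfolding \<eta>_sup using g(2,4) by (rule sup_mono)
    also have "\<dots> = (SUP w\<in>T g2. p w)"
      by (simp add: frame_hom_sup[OF qs, symmetric] qt_\<eta>_sup frame_hom_SUP[OF qs] p_def)
    also have "\<dots> \<le> (SUP v\<in>N. \<eta> v)"
    proof (rule SUP_least)
      fix w assume "w \<in> T g2"
      then have "{g. \<eta> g \<le> p w} \<subseteq> N"
        unfolding N_def by blast
      then show "p w \<le> (SUP v\<in>N. \<eta> v)"
        using SUP_subset_mono[of "{g. \<eta> g \<le> p w}" N \<eta> \<eta>] by (simp add: \<eta>_generates)
    qed
    finally have "sup x1 x2 \<in> cover R N"
      using \<open>directed N\<close> by (intro in_cover_directed directed_\<eta>)
    then show ?thesis
      using cover_mono[OF \<open>N \<subseteq> M\<close>] by blast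
  qed
  obtain S where S: "(u, SUP s\<in>S. gen s) \<in> box_cong"
    using box_SUP by blast
  have S_u: "gen s \<lesssim> u" if "s \<in> S" for s
    using box_le_trans[OF box_le_le[OF SUP_upper[OF that]] box_le_cong[OF box_sym[OF S]]] .
  have "qs (box_map u) = (SUP s\<in>S. qs (qt (\<eta> s)))"
    by (simp add: box_map_cong[OF S] box_map_SUP_gen frame_hom_SUP[OF qs])
  also have "\<dots> \<le> (SUP x\<in>M. \<eta> x)"
  proof (rule SUP_least)
    fix s assume "s \<in> S"
    \<comment> \<open>The witness in the definition of \<open>M\<close> is \<open>s\<close>
      itself.\<close>
    then have "T s \<subseteq> M"
      using S_u T_le_saturation unfolding M_def by blast
    then show "qs (qt (\<eta> s)) \<le> (SUP x\<in>M. \<eta> x)"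
      by (simp add: T SUP_subset_mono)
  qed
  finally have le: "qs (box_map u) \<le> (SUP x\<in>M. \<eta> x)" .
  have "gen g \<lesssim> u" if "\<eta> g \<le> qs (box_map u)" for g
  proof (rule box_cover[OF lower M_u])
    show "g \<in> cover R M"
      by (rule in_cover[OF \<open>M \<noteq> {}\<close> M_sup order_trans[OF that le]])
  qed
  then show ?thesis
    unfolding box_section_def by (intro box_le_SUP_least) simp
qed

text \<open>A generator \<open>s\<close> with \<open>gen s\<close> below \<open>u\<close> need not
  be among those joined in the section, but the members of \<open>T s\<close> are, and their boxes
  join to \<open>gen s\<close>.\<close>

lemma le_box_section: "u \<lesssim> box_section (box_map u)"
proof -
  obtain S where S: "(u, SUP s\<in>S. gen s) \<in> box_cong"
    using box_SUP by blast
  have "gen s \<lesssim> box_section (box_map u)" if "s \<in> S" for s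
  proof -
    have "qt (\<eta> s) \<le> box_map u"
      unfolding box_map_cong[OF S] box_map_SUP_gen using that by (rule SUP_upper)
    then have "qs (qt (\<eta> s)) \<le> qs (box_map u)"
      by (rule frame_hom_mono[OF qs])
    then have "(SUP v\<in>T s. gen v) \<le> box_section (box_map u)"
      unfolding box_section_def using T_le_saturation
      by (intro SUP_subset_mono) (auto intro: order_trans)
    then show ?thesis
      by (rule box_le_trans[OF box_le_cong[OF box_SUP_T] box_le_le])
  qed
  then show ?thesis
    by (intro box_le_trans[OF box_le_cong[OF S]] box_le_SUP_least)
qed

text \<open>Each element is congruent to the section of its image, so elements with equal images are
  congruent.\<close>

lemma box_map_ker: "box_map u = box_map v \<longleftrightarrow> (u, v) \<in> box_cong"
proof
  assume "box_map u = box_map v"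
  then show "(u, v) \<in> box_cong"
    using box_section_le le_box_section by (metis box_le_trans box_le_antisym)
qed (rule box_map_cong)

lemma presents_quotient:
  "\<exists>\<psi> :: 'g free_frame set \<Rightarrow> 'y. presentation_iso (join_relations R \<union> box_relations T) \<psi>"
  using box_map_section by (intro presentation_isoI[OF box_map_hom _ box_map_ker]) (metis surjI)

end

theorem corollary3p8:
  fixes R :: "('g::{distrib_lattice, bounded_lattice} set \<times> 'g set) set"
    and \<phi> :: "'g free_frame set \<Rightarrow> 'x::frame"
    and \<eta> :: "'g \<Rightarrow> 'x"
    and qs :: "'y::frame \<Rightarrow> 'x"
    and qt :: "'x \<Rightarrow> 'y"
    and T :: "'g \<Rightarrow> 'g set"
  assumes "dcpo_type R"
    and "presentation_iso (lattice_relations \<union> join_relations R) \<phi>"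
    and "\<And>g. \<eta> g = \<phi> (presented_class (lattice_relations \<union> join_relations R) (gen g))"
    and "frame_hom qs"
    and "triquotiency_assignment qs qt"
    and "\<And>t. directed (\<eta> ` T t)"
    and "\<And>t. qs (qt (\<eta> t)) = (SUP u\<in>T t. \<eta> u)"
  shows "\<exists>\<psi> :: 'g free_frame set \<Rightarrow> 'y. presentation_iso (join_relations R \<union> box_relations T) \<psi>"
proof -
  interpret presented_triquotient R
    "\<lambda>u. \<phi> (presented_class (lattice_relations \<union> join_relations R) u)" \<eta> qs qt T
    using assms presentation_isoD[OF assms(2)] by unfold_locales auto
  show ?thesis
    by (rule presents_quotient)
qed

end
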